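(* Let $\mathbb{X}_i=\langle X_i,\rho_i\rangle$, $i\in I$, and $\mathbb{Y}_j=\langle Y_j,\sigma_j\rangle$, $j\in J$, be two families of pairwise disjoint connected binary structures, and let $\mathbb{X}=\langle X,\rho\rangle=\langle\bigcup_{i\in I}X_i,\bigcup_{i\in I}\rho_i\rangle$ and $\mathbb{Y}=\langle Y,\sigma\rangle=\langle\bigcup_{j\in J}Y_j,\bigcup_{j\in J}\sigma_j\rangle$ be their disjoint unions. Then: (a) $F$ is an embedding of $\mathbb{X}$ into $\mathbb{Y}$ iff there are $f:I\to J$ and embeddings $g_i:\mathbb{X}_i\hookrightarrow\mathbb{Y}_{f(i)}$, $i\in I$, such that $F=\bigcup_{i\in I}g_i$ and for all distinct $i_1,i_2\in I$, all $x_{i_1}\in X_{i_1}$ and all $x_{i_2}\in X_{i_2}$ we have $\neg\, g_{i_1}(x_{i_1})\,\sigma_{rs}\,g_{i_2}(x_{i_2})$; (b) $C\in\mathbb{P}(\mathbb{X})$ iff there are $f:I\to I$ and embeddings $g_i:\mathbb{X}_i\hookrightarrow\mathbb{X}_{f(i)}$, $i\in I$, such that $C=\bigcup_{i\in I}g_i[X_i]$ and for all distinct $i,j\in I$, all $x\in X_i$ and all $y\in X_j$ we have $\neg\, g_i(x)\,\rho_{rs}\,g_j(y)$.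
   Context: An embedding is an injection $g$ with $\langle u,v\rangle\in\rho\Leftrightarrow\langle g(u),g(v)\rangle\in\sigma$. For a binary relation $\sigma$ on $Y$, $\sigma_{rs}=\Delta_Y\cup\sigma\cup\sigma^{-1}$. A binary structure is connected iff the transitive closure of $\Delta\cup\sigma\cup\sigma^{-1}$ has exactly one class. $\mathbb{P}(\mathbb{X})=\{F[X]: F \text{ an embedding of } \mathbb{X} \text{ into itself}\}$. *)

theory Defs
  imports Main "HOL-Library.FuncSet" "HOL-Library.Disjoint_Sets"
begin

text \<open>
  A binary structure is given by a carrier set and a relation on it, as two separate arguments.
  Maps are total HOL functions of which only the values on the carrier matter; the union of maps
  is taken on their graphs over the respective carriers.
\<close>

definition binary_structure :: "'a set \<Rightarrow> 'a rel \<Rightarrow> bool" where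
  "binary_structure X \<rho> \<longleftrightarrow> \<rho> \<subseteq> X \<times> X"

definition rs_closure :: "'a set \<Rightarrow> 'a rel \<Rightarrow> 'a rel" where
  "rs_closure X \<rho> = Id_on X \<union> \<rho> \<union> \<rho>\<inverse>"

text \<open>
  The empty structure has no class at all and is therefore not connected.
\<close>

definition connected_structure :: "'a set \<Rightarrow> 'a rel \<Rightarrow> bool" where
  "connected_structure X \<rho> \<longleftrightarrow>
     binary_structure X \<rho> \<and> is_singleton (X // (rs_closure X \<rho>)\<^sup>+)"

definition embedding :: "'a set \<Rightarrow> 'a rel \<Rightarrow> 'b set \<Rightarrow> 'b rel \<Rightarrow> ('a \<Rightarrow> 'b) \<Rightarrow> bool" where
  "embedding X \<rho> Y \<sigma> g \<longleftrightarrow>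
     g \<in> X \<rightarrow> Y \<and> inj_on g X \<and> (\<forall>u\<in>X. \<forall>v\<in>X. (u, v) \<in> \<rho> \<longleftrightarrow> (g u, g v) \<in> \<sigma>)"

definition copies :: "'a set \<Rightarrow> 'a rel \<Rightarrow> 'a set set" where
  "copies X \<rho> = {F ` X |F. embedding X \<rho> X \<rho> F}"

definition fun_graph :: "'a set \<Rightarrow> ('a \<Rightarrow> 'b) \<Rightarrow> ('a \<times> 'b) set" where
  "fun_graph A f = {(x, f x) |x. x \<in> A}"

end

(* Both implications rest on the fact that a component of a disjoint union absorbs every point
   that is rs-related to one of its points. An embedding preserves and reflects the rs-relation.
   Since it preserves it, the image of a connected component stays in a single component of the
   target; since it reflects it, different components have unrelated images. Conversely,
   unrelated images make the glued map injective (the rs-relation is reflexive) and reflect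
   non-edges between different components. *)
theory Submission imports Defs begin

text \<open>The images of \<open>x\<close> and \<open>y\<close> under the closure both belong to a
  one-element quotient, so they coincide; the diagonal puts \<open>y\<close> into its own image,
  hence into that of \<open>x\<close>.\<close>

lemma connected_structure_trancl:
  assumes "connected_structure A r" "x \<in> A" "y \<in> A"
  shows "(x, y) \<in> (rs_closure A r)\<^sup>+"
proof -
  let ?R = "(rs_closure A r)\<^sup>+"
  obtain c where c: "A // ?R = {c}"
    using assms(1) unfolding connected_structure_def by (elim conjE is_singletonE)
  have "?R `` {x} = ?R `` {y}"
    using c quotientI[OF assms(2), of ?R] quotientI[OF assms(3), of ?R] by simp
  moreover have "(y, y) \<in> ?R"
    using assms(3) by (intro r_into_trancl) (auto simp: rs_closure_def)
  ultimately show ?thesis by blast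
qed

lemma connected_structure_nonempty: "connected_structure A r \<Longrightarrow> A \<noteq> {}"
  by (auto simp: connected_structure_def is_singleton_def)

lemma rs_closure_subset: "binary_structure A r \<Longrightarrow> rs_closure A r \<subseteq> A \<times> A"
  by (auto simp: rs_closure_def binary_structure_def)

text \<open>Injectivity settles the diagonal part, the edge equivalence the other two. Reading right
  to left keeps components together, left to right keeps them apart.\<close>

lemma embedding_rs_closure_iff:
  assumes "embedding X \<rho> Y \<sigma> F" "x \<in> X" "y \<in> X"
  shows "(F x, F y) \<in> rs_closure Y \<sigma> \<longleftrightarrow> (x, y) \<in> rs_closure X \<rho>"
  using assms unfolding embedding_def rs_closure_def by (auto simp: inj_on_eq_iff)

lemma rs_closure_mono:
  "A \<subseteq> B \<Longrightarrow> r \<subseteq> s \<Longrightarrow> rs_closure A r \<subseteq> rs_closure B s"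
  by (auto simp: rs_closure_def)

text \<open>The source family is the context and the target family a second instance, so the facts
  on components serve both sides; letting the two coincide leads to (b).\<close>

locale disjoint_union =
  fixes I :: "'i set" and Xs :: "'i \<Rightarrow> 'a set" and \<rho>s :: "'i \<Rightarrow> 'a rel"
  assumes connected: "\<And>i. i \<in> I \<Longrightarrow> connected_structure (Xs i) (\<rho>s i)"
    and disjoint: "disjoint_family_on Xs I"
begin

abbreviation "carrier \<equiv> \<Union>i\<in>I. Xs i"
abbreviation "edges \<equiv> \<Union>i\<in>I. \<rho>s i"

lemma edges_within: "i \<in> I \<Longrightarrow> \<rho>s i \<subseteq> Xs i \<times> Xs i"
  using connected by (auto simp: connected_structure_def binary_structure_def)

lemma index_unique: "\<lbrakk>i \<in> I; j \<in> I; x \<in> Xs i; x \<in> Xs j\<rbrakk> \<Longrightarrow> i = j"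
  using disjoint by (auto simp: disjoint_family_on_def)

text \<open>An edge of the union lies in some \<open>\<rho>s j\<close>, hence starts in
  \<open>Xs j\<close>, and disjointness forces \<open>j = i\<close>. This passes between global and
  local edges.\<close>

lemma edge_iff:
  assumes "i \<in> I" "x \<in> Xs i"
  shows "(x, y) \<in> edges \<longleftrightarrow> (x, y) \<in> \<rho>s i"
  using assms edges_within index_unique by blast

lemma rs_closure_component:
  assumes "(x, y) \<in> rs_closure carrier edges" "i \<in> I" "x \<in> Xs i"
  shows "y \<in> Xs i"
  using assms edges_within index_unique unfolding rs_closure_def by blast

text \<open>One point of \<open>Xs i\<close> selects the target component \<open>j\<close>. Every
  other point is reached from it by a chain of rs-steps, whose images are rs-steps of the target and
  so cannot leave \<open>Ys j\<close>.\<close>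

lemma component_image:
  assumes J: "disjoint_union J Ys \<sigma>s" and i: "i \<in> I"
    and F: "embedding carrier edges (\<Union>j\<in>J. Ys j) (\<Union>j\<in>J. \<sigma>s j) F"
  shows "\<exists>j\<in>J. F ` Xs i \<subseteq> Ys j"
proof -
  interpret Y: disjoint_union J Ys \<sigma>s by (rule J)
  obtain x where x: "x \<in> Xs i"
    using connected_structure_nonempty[OF connected[OF i]] by blast
  then obtain j where j: "j \<in> J" "F x \<in> Ys j"
    using F i unfolding embedding_def by blast
  have "F y \<in> Ys j" if "(x, y) \<in> (rs_closure (Xs i) (\<rho>s i))\<^sup>+" for y
  proof -
    have step: "F v \<in> Ys j" if "(u, v) \<in> rs_closure (Xs i) (\<rho>s i)" "F u \<in> Ys j" for u v
    proof -
      have "(u, v) \<in> rs_closure carrier edges"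
        using that(1) i rs_closure_mono[of "Xs i" carrier "\<rho>s i" edges] by blast
      moreover have "u \<in> carrier" "v \<in> carrier"
        using that(1) rs_closure_subset[of "Xs i" "\<rho>s i"] edges_within[OF i] i
        by (auto simp: binary_structure_def)
      ultimately show ?thesis
        using embedding_rs_closure_iff[OF F] Y.rs_closure_component j(1) that(2) by blast
    qed
    show ?thesis using that by induction (use step j(2) in blast)+
  qed
  then show ?thesis
    using connected_structure_trancl[OF connected[OF i] x] j(1) by blast
qed

lemma fun_graph_Union_iff:
  "fun_graph carrier F = (\<Union>i\<in>I. fun_graph (Xs i) (g i)) \<longleftrightarrow>
    (\<forall>i\<in>I. \<forall>x\<in>Xs i. F x = g i x)" (is "?L \<longleftrightarrow> ?R")
proof
  assume eq: ?L
  show ?R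
  proof (intro ballI)
    fix i x assume "i \<in> I" "x \<in> Xs i"
    then have "(x, g i x) \<in> fun_graph carrier F"
      unfolding eq by (auto simp: fun_graph_def)
    then show "F x = g i x" by (simp add: fun_graph_def)
  qed
qed (auto simp: fun_graph_def)

text \<open>This is (a). The target is named by the equations for \<open>Y\<close> and
  \<open>\<sigma>\<close>, so that it can be instantiated both by the variables of the theorem and,
  through \<open>refl\<close>, by the unions themselves.\<close>

lemma embedding_iff:
  assumes J: "disjoint_union J Ys \<sigma>s"
    and Y: "Y = (\<Union>j\<in>J. Ys j)" "\<sigma> = (\<Union>j\<in>J. \<sigma>s j)"
  shows "embedding carrier edges Y \<sigma> F \<longleftrightarrow>
    (\<exists>f g. f \<in> I \<rightarrow> J
      \<and> (\<forall>i\<in>I. embedding (Xs i) (\<rho>s i) (Ys (f i)) (\<sigma>s (f i)) (g i))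
      \<and> fun_graph carrier F = (\<Union>i\<in>I. fun_graph (Xs i) (g i))
      \<and> (\<forall>i\<in>I. \<forall>j\<in>I. i \<noteq> j \<longrightarrow>
           (\<forall>x\<in>Xs i. \<forall>y\<in>Xs j. (g i x, g j y) \<notin> rs_closure Y \<sigma>)))"
    (is "?L \<longleftrightarrow> ?R")
proof
  interpret Y: disjoint_union J Ys \<sigma>s by (rule J)
  assume F: ?L
  obtain f where f: "\<And>i. i \<in> I \<Longrightarrow> f i \<in> J" "\<And>i. i \<in> I \<Longrightarrow> F ` Xs i \<subseteq> Ys (f i)"
    using component_image[OF J _ F[unfolded Y]] by metis
  show ?R
  \<comment> \<open>Only values on the carrier matter, so \<open>F\<close> itself serves as its
    restriction to each component.\<close>
  proof (intro exI[of _ f] exI[of _ "\<lambda>_. F"] conjI ballI impI)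
    fix i assume i: "i \<in> I"
    have "(u, v) \<in> \<rho>s i \<longleftrightarrow> (F u, F v) \<in> \<sigma>s (f i)" if uv: "u \<in> Xs i" "v \<in> Xs i" for u v
    proof -
      have "(u, v) \<in> \<rho>s i \<longleftrightarrow> (u, v) \<in> edges" using edge_iff[OF i uv(1)] by simp
      also have "\<dots> \<longleftrightarrow> (F u, F v) \<in> \<sigma>"
        using F uv i unfolding embedding_def by blast
      also have "\<dots> \<longleftrightarrow> (F u, F v) \<in> \<sigma>s (f i)"
        unfolding Y using Y.edge_iff[of "f i" "F u"] f[OF i] uv by blast
      finally show ?thesis .
    qed
    moreover have "inj_on F (Xs i)"
      using F i unfolding embedding_def by (blast intro: inj_on_subset)
    ultimately show "embedding (Xs i) (\<rho>s i) (Ys (f i)) (\<sigma>s (f i)) F"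
      using f(2)[OF i] unfolding embedding_def by blast
  next
    fix i j x y assume xy: "i \<in> I" "j \<in> I" "i \<noteq> j" "x \<in> Xs i" "y \<in> Xs j"
    then have "(x, y) \<notin> rs_closure carrier edges"
      using rs_closure_component[of x y i] index_unique[of i j y] by blast
    then show "(F x, F y) \<notin> rs_closure Y \<sigma>"
      using embedding_rs_closure_iff[OF F, of x y] xy by blast
  qed (use f(1) in \<open>auto simp: fun_graph_Union_iff\<close>)
next
  interpret Y: disjoint_union J Ys \<sigma>s by (rule J)
  assume ?R
  then obtain f g where fg: "f \<in> I \<rightarrow> J"
      "\<forall>i\<in>I. embedding (Xs i) (\<rho>s i) (Ys (f i)) (\<sigma>s (f i)) (g i)"
      "\<forall>i\<in>I. \<forall>x\<in>Xs i. F x = g i x"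
      "\<forall>i\<in>I. \<forall>j\<in>I. i \<noteq> j \<longrightarrow>
         (\<forall>x\<in>Xs i. \<forall>y\<in>Xs j. (g i x, g j y) \<notin> rs_closure Y \<sigma>)"
    unfolding fun_graph_Union_iff by (elim exE conjE)
  note f = funcset_mem[OF fg(1)] and g = bspec[OF fg(2)] and Fg = fg(3)[rule_format]
    and sep = fg(4)[rule_format]
  have into: "F x \<in> Ys (f i)" if "i \<in> I" "x \<in> Xs i" for i x
    using g[OF that(1)] Fg[OF that] that(2) by (auto simp: embedding_def)
  have into_Y: "F x \<in> Y" if "x \<in> carrier" for x
    using that into f unfolding Y by blast
  \<comment> \<open>Injectivity and the edge equivalence are proved together, since both split on
    whether \<open>u\<close> and \<open>v\<close> share a component.\<close>
  have pair: "(F u = F v \<longrightarrow> u = v) \<and> ((u, v) \<in> edges \<longleftrightarrow> (F u, F v) \<in> \<sigma>)"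
    if u: "u \<in> carrier" and v: "v \<in> carrier" for u v
  proof -
    obtain i j where ij: "i \<in> I" "j \<in> I" "u \<in> Xs i" "v \<in> Xs j" using u v by blast
    show ?thesis
    proof (cases "i = j")
      case True
      then have v: "v \<in> Xs i" using ij by simp
      have "(u, v) \<in> edges \<longleftrightarrow> (F u, F v) \<in> \<sigma>s (f i)"
        using g[OF ij(1)] edge_iff[OF ij(1,3)] ij(3) v Fg[OF ij(1)]
        by (simp add: embedding_def)
      then show ?thesis
        using Y.edge_iff[OF f into, OF ij(1) ij(1) ij(3)] g[OF ij(1)] ij(3) v Fg[OF ij(1)]
        unfolding Y embedding_def by (auto simp: inj_on_eq_iff)
    next
      case False
      then have "(F u, F v) \<notin> rs_closure Y \<sigma>" using sep ij Fg by metis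
      moreover have "(u, v) \<notin> edges"
        using edge_iff[OF ij(1,3)] edges_within index_unique ij False by blast
      \<comment> \<open>As \<open>F u\<close> lies in \<open>Y\<close>, equality of
        \<open>F u\<close> and \<open>F v\<close> would put the pair on the diagonal of the closure;
        an edge between them would lie in the closure as well.\<close>
      ultimately show ?thesis
        using into_Y[OF u] by (auto simp: rs_closure_def)
    qed
  qed
  show ?L
    unfolding embedding_def inj_on_def using into_Y pair by blast
qed

text \<open>Disjointness makes the index of a point of the carrier unique, so \<open>THE\<close>
  finds it; elsewhere the value is irrelevant. In (b) only the \<open>g i\<close> are given, and
  this supplies the self-embedding.\<close>

lemma glue_maps: "\<exists>F. \<forall>i\<in>I. \<forall>x\<in>Xs i. F x = g i x"
proof -
  have "(THE j. j \<in> I \<and> x \<in> Xs j) = i" if "i \<in> I" "x \<in> Xs i" for i x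
    using that index_unique by blast
  then show ?thesis
    by (intro exI[of _ "\<lambda>x. g (THE i. i \<in> I \<and> x \<in> Xs i) x"]) simp
qed

lemma copies_iff:
  "C \<in> copies carrier edges \<longleftrightarrow>
    (\<exists>f g. f \<in> I \<rightarrow> I
      \<and> (\<forall>i\<in>I. embedding (Xs i) (\<rho>s i) (Xs (f i)) (\<rho>s (f i)) (g i))
      \<and> C = (\<Union>i\<in>I. g i ` Xs i)
      \<and> (\<forall>i\<in>I. \<forall>j\<in>I. i \<noteq> j \<longrightarrow>
           (\<forall>x\<in>Xs i. \<forall>y\<in>Xs j. (g i x, g j y) \<notin> rs_closure carrier edges)))"
    (is "_ \<longleftrightarrow> (\<exists>f g. ?f f \<and> ?emb f g \<and> ?C g \<and> ?sep g)")
proof -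
  have image: "F ` carrier = (\<Union>i\<in>I. g i ` Xs i)"
    if "\<forall>i\<in>I. \<forall>x\<in>Xs i. F x = g i x" for F g
    using that by (force simp: image_iff)
  \<comment> \<open>Here (a) is applied with the family itself as target, and the graph equation is
    traded for pointwise agreement, the form in which \<open>image\<close> and
    \<open>glue_maps\<close> are stated.\<close>
  have embedding_carrier_iff: "embedding carrier edges carrier edges F \<longleftrightarrow>
      (\<exists>f g. ?f f \<and> ?emb f g \<and> (\<forall>i\<in>I. \<forall>x\<in>Xs i. F x = g i x) \<and> ?sep g)" for F
    unfolding embedding_iff[OF disjoint_union_axioms refl refl] fun_graph_Union_iff ..
  show ?thesis
  proof
    assume "C \<in> copies carrier edges"
    then obtain F where C: "C = F ` carrier" and "embedding carrier edges carrier edges F"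
      unfolding copies_def by blast
    then obtain f g where fg: "?f f" "?emb f g" "?sep g"
      and F: "\<forall>i\<in>I. \<forall>x\<in>Xs i. F x = g i x"
      unfolding embedding_carrier_iff by (elim exE conjE)
    show "\<exists>f g. ?f f \<and> ?emb f g \<and> ?C g \<and> ?sep g"
      by (intro exI conjI) (fact fg C[unfolded image[OF F]])+
  next
    assume "\<exists>f g. ?f f \<and> ?emb f g \<and> ?C g \<and> ?sep g"
    then obtain f g where fg: "?f f" "?emb f g" "?sep g" and C: "?C g"
      by (elim exE conjE)
    obtain F where F: "\<forall>i\<in>I. \<forall>x\<in>Xs i. F x = g i x" using glue_maps by blast
    have "embedding carrier edges carrier edges F"
      unfolding embedding_carrier_iff by (intro exI conjI) (fact fg F)+
    then show "C \<in> copies carrier edges"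
      unfolding copies_def C image[OF F, symmetric] by blast
  qed
qed

end

theorem theorem7p5:
  fixes I :: "'i set" and J :: "'j set"
    and Xs :: "'i \<Rightarrow> 'a set" and \<rho>s :: "'i \<Rightarrow> 'a rel"
    and Ys :: "'j \<Rightarrow> 'b set" and \<sigma>s :: "'j \<Rightarrow> 'b rel"
    and X :: "'a set" and \<rho> :: "'a rel" and Y :: "'b set" and \<sigma> :: "'b rel"
  assumes "\<And>i. i \<in> I \<Longrightarrow> connected_structure (Xs i) (\<rho>s i)"
    and "disjoint_family_on Xs I"
    and "\<And>j. j \<in> J \<Longrightarrow> connected_structure (Ys j) (\<sigma>s j)"
    and "disjoint_family_on Ys J"
    and "X = (\<Union>i\<in>I. Xs i)" and "\<rho> = (\<Union>i\<in>I. \<rho>s i)"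
    and "Y = (\<Union>j\<in>J. Ys j)" and "\<sigma> = (\<Union>j\<in>J. \<sigma>s j)"
  shows "(\<forall>F. embedding X \<rho> Y \<sigma> F \<longleftrightarrow>
      (\<exists>f g. f \<in> I \<rightarrow> J
        \<and> (\<forall>i\<in>I. embedding (Xs i) (\<rho>s i) (Ys (f i)) (\<sigma>s (f i)) (g i))
        \<and> fun_graph X F = (\<Union>i\<in>I. fun_graph (Xs i) (g i))
        \<and> (\<forall>i\<^sub>1\<in>I. \<forall>i\<^sub>2\<in>I. i\<^sub>1 \<noteq> i\<^sub>2 \<longrightarrow>
             (\<forall>x\<^sub>1\<in>Xs i\<^sub>1. \<forall>x\<^sub>2\<in>Xs i\<^sub>2. (g i\<^sub>1 x\<^sub>1, g i\<^sub>2 x\<^sub>2) \<notin> rs_closure Y \<sigma>))))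
    \<and> (\<forall>C. C \<in> copies X \<rho> \<longleftrightarrow>
      (\<exists>f g. f \<in> I \<rightarrow> I
        \<and> (\<forall>i\<in>I. embedding (Xs i) (\<rho>s i) (Xs (f i)) (\<rho>s (f i)) (g i))
        \<and> C = (\<Union>i\<in>I. g i ` Xs i)
        \<and> (\<forall>i\<in>I. \<forall>j\<in>I. i \<noteq> j \<longrightarrow>
             (\<forall>x\<in>Xs i. \<forall>y\<in>Xs j. (g i x, g j y) \<notin> rs_closure X \<rho>))))"
proof -
  interpret X: disjoint_union I Xs \<rho>s using assms(1,2) by unfold_locales
  have J: "disjoint_union J Ys \<sigma>s" using assms(3,4) by unfold_locales
  show ?thesis
    unfolding assms(5,6)
    by (intro conjI allI X.embedding_iff[OF J assms(7,8)] X.copies_iff)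
qed

end
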